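(* Let $a,b$ be nonzero elements in a domain $R$ such that $aR+bR=R$. Then the following are equivalent: (i) There exist an integer $n>0$ and elements $a_i,b_i,c_i,d_i\in R$, $i=1,\dots,n$, such that $a_1=c_1=1$, $b_1=0$, $c_n=a$, $d_n=b$, $c_ia_i+d_ib_i=1$ for $1\le i\le n$, and $c_ia_{i+1}+d_ib_{i+1}=1$ for $1\le i\le n-1$. (ii) There exist an integer $n>0$ and elements $a_i,b_i,c_i,d_i\in R$, $1\le i\le n$, such that the matrix $\begin{pmatrix} a & b\\ 0&0\end{pmatrix}$ can be written as a product $E_1\cdots E_n$ of idempotent matrices $E_i^2=E_i$, where $$E_i=\begin{pmatrix} a_ic_i & a_id_i\\ b_ic_i& b_id_i\end{pmatrix}=\begin{pmatrix} a_i\\ b_i\end{pmatrix}(c_i,d_i).$$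
   Context: Rings are associative with identity and need not be commutative; a domain is a (not necessarily commutative) nonzero ring without zero divisors. *)

theory Defs
  imports "HOL-Analysis.Analysis"
begin

definition mat2 :: "'a::zero \<Rightarrow> 'a \<Rightarrow> 'a \<Rightarrow> 'a \<Rightarrow> 'a^2^2" where
  "mat2 p q r s = vector [vector [p, q], vector [r, s]]"

definition col_row :: "'a::semiring_1 \<Rightarrow> 'a \<Rightarrow> 'a \<Rightarrow> 'a \<Rightarrow> 'a^2^2" where
  "col_row a b c d = mat2 (a * c) (a * d) (b * c) (b * d)"

lemma col_row_eq_matrix_mult:
  fixes a b c d :: "'a::semiring_1"
  shows "col_row a b c d =
    (vector [vector [a], vector [b]] :: 'a^1^2) ** (vector [vector [c, d]] :: 'a^2^1)"
  by (simp add: col_row_def mat2_def matrix_matrix_mult_def vec_eq_iff forall_2 sum_1 vector_def)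

text \<open>
  The multiplication \<open>*\<close> on \<open>'a^2^2\<close> is componentwise, so \<open>prod_list\<close> is not the
  matrix product.  The factors are multiplied from left to right.
\<close>

definition mat_prod_list :: "('a::semiring_1^'n^'n) list \<Rightarrow> 'a^'n^'n" where
  "mat_prod_list Es = foldr (**) Es (mat 1)"

end

theory Submission
  imports Defs
begin

text \<open>
  Write \<open>v\<^sub>i\<close> for the column \<open>(\<alpha>\<^sub>i, \<beta>\<^sub>i)\<close> and \<open>w\<^sub>i\<close> for the row \<open>(\<gamma>\<^sub>i, \<delta>\<^sub>i)\<close>, so that
  \<open>E\<^sub>i = v\<^sub>i w\<^sub>i\<close>.  A product of such matrices telescopes into the scalars
  \<open>u\<^sub>i = w\<^sub>i v\<^sub>i\<^sub>+\<^sub>1\<close> between consecutive factors: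
  \<open>E\<^sub>1 \<cdots> E\<^sub>n = v\<^sub>1 (u\<^sub>1 \<cdots> u\<^sub>n\<^sub>-\<^sub>1) w\<^sub>n\<close> (lemma \<open>mat_prod_list_col_row\<close>).

  In (i) the equations say that \<open>w\<^sub>i v\<^sub>i = 1\<close>, which makes \<open>E\<^sub>i\<close> idempotent, and that
  all \<open>u\<^sub>i\<close> are \<open>1\<close>.  Hence the product is \<open>v\<^sub>1 w\<^sub>n\<close>, with \<open>v\<^sub>1 = (1, 0)\<close> and
  \<open>w\<^sub>n = (a, b)\<close>.

  Conversely, in a domain a nonzero idempotent \<open>v w\<close> satisfies \<open>w v = 1\<close> (lemma
  \<open>idempotent_col_row_imp_row_col_one\<close>), and here no factor vanishes because \<open>a \<noteq> 0\<close>.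
  The data then differ from (i) only by a rescaling \<open>v\<^sub>i \<mapsto> v\<^sub>i \<lambda>\<^sub>i\<close>,
  \<open>w\<^sub>i \<mapsto> p\<^sub>i w\<^sub>i\<close>, where \<open>p\<^sub>i = \<alpha>\<^sub>1 u\<^sub>1 \<cdots> u\<^sub>i\<^sub>-\<^sub>1\<close> and \<open>p\<^sub>i \<lambda>\<^sub>i = 1\<close>.  Indeed
  \<open>p\<^sub>n w\<^sub>n\<close> is the top row \<open>(a, b)\<close> of the product, and
  \<open>p\<^sub>i w\<^sub>i v\<^sub>i\<^sub>+\<^sub>1 \<lambda>\<^sub>i\<^sub>+\<^sub>1 = p\<^sub>i\<^sub>+\<^sub>1 \<lambda>\<^sub>i\<^sub>+\<^sub>1 = 1\<close>.  The right inverses \<open>\<lambda>\<^sub>i\<close> exist because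
  \<open>a x + b y = 1\<close> has a solution: it reads \<open>p\<^sub>n (w\<^sub>n (x, y)) = 1\<close>, and every \<open>p\<^sub>i\<close> is an
  initial factor of \<open>p\<^sub>n\<close>.  The zero bottom row of the product forces \<open>\<beta>\<^sub>1 = 0\<close>, so that
  \<open>w\<^sub>1 v\<^sub>1 = 1\<close> becomes \<open>\<gamma>\<^sub>1 \<alpha>\<^sub>1 = 1\<close>; hence \<open>\<lambda>\<^sub>1 = \<gamma>\<^sub>1\<close> is a two-sided inverse of
  \<open>p\<^sub>1 = \<alpha>\<^sub>1\<close>, and the rescaled data start as (i) requires.
\<close>

lemma mat2_mult:
  fixes a b c d :: "'a::semiring_1"
  shows "mat2 a b c d ** mat2 p q r s =
    mat2 (a * p + b * r) (a * q + b * s) (c * p + d * r) (c * q + d * s)"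
  by (simp add: mat2_def matrix_matrix_mult_def vec_eq_iff forall_2 sum_2)

lemma mat2_eq_iff: "mat2 a b c d = mat2 p q r s \<longleftrightarrow> a = p \<and> b = q \<and> c = r \<and> d = s"
  by (auto simp: mat2_def vec_eq_iff forall_2)

lemma mat2_eq_0_iff: "mat2 a b c d = 0 \<longleftrightarrow> a = 0 \<and> b = 0 \<and> c = 0 \<and> d = 0"
  by (auto simp: mat2_def vec_eq_iff forall_2)

lemma col_row_mult:
  fixes a b c d :: "'a::semiring_1"
  shows "col_row a b c d ** col_row a' b' c' d' =
    col_row a b ((c * a' + d * b') * c') ((c * a' + d * b') * d')"
  by (simp add: col_row_def mat2_mult algebra_simps)

lemma mat_prod_list_snoc: "mat_prod_list (xs @ [x]) = mat_prod_list xs ** x"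
  by (induction xs) (simp_all add: mat_prod_list_def matrix_mul_assoc)

lemma mat_prod_list_eq_0:
  assumes "0 \<in> set xs"
  shows "mat_prod_list xs = 0"
  using assms
  by (induction xs) (auto simp: mat_prod_list_def matrix_matrix_mult_def vec_eq_iff)

text \<open>
  The argument counts the links \<open>u\<^sub>i = w\<^sub>i v\<^sub>i\<^sub>+\<^sub>1\<close>, so \<open>k\<close> links belong to a product of
  \<open>k + 1\<close> matrices.
\<close>

primrec link_prod ::
  "(nat \<Rightarrow> 'a::semiring_1) \<Rightarrow> (nat \<Rightarrow> 'a) \<Rightarrow> (nat \<Rightarrow> 'a) \<Rightarrow> (nat \<Rightarrow> 'a) \<Rightarrow> nat \<Rightarrow> 'a" where
  "link_prod \<alpha> \<beta> \<gamma> \<delta> 0 = 1"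
| "link_prod \<alpha> \<beta> \<gamma> \<delta> (Suc k) = link_prod \<alpha> \<beta> \<gamma> \<delta> k *
     (\<gamma> (Suc k) * \<alpha> (Suc (Suc k)) + \<delta> (Suc k) * \<beta> (Suc (Suc k)))"

lemma link_prod_initial_factor:
  assumes "j \<le> k"
  shows "\<exists>r. link_prod \<alpha> \<beta> \<gamma> \<delta> k = link_prod \<alpha> \<beta> \<gamma> \<delta> j * r"
  using assms
proof (induction k rule: dec_induct)
  case base
  show ?case by (rule exI[of _ 1]) simp
next
  case (step k)
  then show ?case by (metis link_prod.simps(2) mult.assoc)
qed

lemma link_prod_eq_1:
  assumes "\<And>i. i \<in> {1..k} \<Longrightarrow> \<gamma> i * \<alpha> (i + 1) + \<delta> i * \<beta> (i + 1) = 1"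
  shows "link_prod \<alpha> \<beta> \<gamma> \<delta> k = 1"
  using assms by (induction k) auto

text \<open>
  The associative law lets each interior pair row times column be evaluated first, as a
  scalar; only the outermost column and row survive.
\<close>

lemma mat_prod_list_col_row:
  assumes "\<And>i. i \<in> {1..Suc k} \<Longrightarrow> E i = col_row (\<alpha> i) (\<beta> i) (\<gamma> i) (\<delta> i)"
  shows "mat_prod_list (map E [1..<Suc k + 1]) =
    col_row (\<alpha> 1) (\<beta> 1) (link_prod \<alpha> \<beta> \<gamma> \<delta> k * \<gamma> (Suc k)) (link_prod \<alpha> \<beta> \<gamma> \<delta> k * \<delta> (Suc k))"
  using assms
proof (induction k)
  case 0
  then show ?case by (simp add: mat_prod_list_def)
next
  case (Suc k)
  have "mat_prod_list (map E [1..<Suc (Suc k) + 1]) =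
      mat_prod_list (map E [1..<Suc k + 1]) ** E (Suc (Suc k))"
    using mat_prod_list_snoc[of "map E [1..<Suc k + 1]" "E (Suc (Suc k))"] by simp
  also have "\<dots> = col_row (\<alpha> 1) (\<beta> 1)
      (link_prod \<alpha> \<beta> \<gamma> \<delta> k * \<gamma> (Suc k)) (link_prod \<alpha> \<beta> \<gamma> \<delta> k * \<delta> (Suc k)) **
      col_row (\<alpha> (Suc (Suc k))) (\<beta> (Suc (Suc k))) (\<gamma> (Suc (Suc k))) (\<delta> (Suc (Suc k)))"
    using Suc by simp
  finally show ?case by (simp add: col_row_mult algebra_simps)
qed

lemma col_row_idempotent:
  assumes "c * a + d * b = 1"
  shows "col_row a b c d ** col_row a b c d = col_row a b c d"
  using assms by (simp add: col_row_mult)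

text \<open>
  Idempotency says \<open>v (w v - 1) w = 0\<close>; the nonzero entries of \<open>v\<close> and \<open>w\<close> can be cancelled.
\<close>

lemma idempotent_col_row_imp_row_col_one:
  fixes a b c d :: "'a::ring_1_no_zero_divisors"
  assumes idem: "col_row a b c d ** col_row a b c d = col_row a b c d"
    and nz: "col_row a b c d \<noteq> 0"
  shows "c * a + d * b = 1"
proof -
  obtain x y where xy: "x \<in> {a, b}" "y \<in> {c, d}" "x \<noteq> 0" "y \<noteq> 0"
    using nz by (auto simp: col_row_def mat2_eq_0_iff)
  have "x * ((c * a + d * b) * y) = x * y"
    using idem xy by (auto simp: col_row_mult) (auto simp: col_row_def mat2_eq_iff)
  then show ?thesis
    using xy by simp
qed

theorem proposition14:
  fixes a b :: "'a::ring_1_no_zero_divisors"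
  assumes "a \<noteq> 0" and "b \<noteq> 0"
    and "{a * x + b * y | x y. True} = UNIV"
  shows
    "(\<exists>(n::nat) (\<alpha> :: nat \<Rightarrow> 'a) (\<beta> :: nat \<Rightarrow> 'a) (\<gamma> :: nat \<Rightarrow> 'a) (\<delta> :: nat \<Rightarrow> 'a).
        n > 0 \<and> \<alpha> 1 = 1 \<and> \<gamma> 1 = 1 \<and> \<beta> 1 = 0 \<and> \<gamma> n = a \<and> \<delta> n = b \<and>
        (\<forall>i\<in>{1..n}. \<gamma> i * \<alpha> i + \<delta> i * \<beta> i = 1) \<and>
        (\<forall>i\<in>{1..<n}. \<gamma> i * \<alpha> (i + 1) + \<delta> i * \<beta> (i + 1) = 1))
     \<longleftrightarrow>
     (\<exists>(n::nat) (\<alpha> :: nat \<Rightarrow> 'a) (\<beta> :: nat \<Rightarrow> 'a) (\<gamma> :: nat \<Rightarrow> 'a) (\<delta> :: nat \<Rightarrow> 'a)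
        (E :: nat \<Rightarrow> 'a^2^2).
        n > 0 \<and>
        (\<forall>i\<in>{1..n}. E i = col_row (\<alpha> i) (\<beta> i) (\<gamma> i) (\<delta> i) \<and> E i ** E i = E i) \<and>
        mat2 a b 0 0 = mat_prod_list (map E [1..<n + 1]))"
  (is "?lhs \<longleftrightarrow> ?rhs")
proof
  assume ?lhs
  then obtain n and \<alpha> \<beta> \<gamma> \<delta> :: "nat \<Rightarrow> 'a" where n: "n > 0"
    and ends: "\<alpha> 1 = 1" "\<beta> 1 = 0" "\<gamma> n = a" "\<delta> n = b"
    and diag: "\<forall>i\<in>{1..n}. \<gamma> i * \<alpha> i + \<delta> i * \<beta> i = 1"
    and link: "\<forall>i\<in>{1..<n}. \<gamma> i * \<alpha> (i + 1) + \<delta> i * \<beta> (i + 1) = 1"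
    by blast
  obtain k where k: "n = Suc k"
    using n by (cases n) auto
  define E where "E i = col_row (\<alpha> i) (\<beta> i) (\<gamma> i) (\<delta> i)" for i
  have "link_prod \<alpha> \<beta> \<gamma> \<delta> k = 1"
    by (rule link_prod_eq_1) (use link k in auto)
  then have "mat_prod_list (map E [1..<n + 1]) = mat2 a b 0 0"
    using mat_prod_list_col_row[of k E \<alpha> \<beta> \<gamma> \<delta>] ends k
    by (simp add: E_def col_row_def)
  moreover have "\<forall>i\<in>{1..n}. E i = col_row (\<alpha> i) (\<beta> i) (\<gamma> i) (\<delta> i) \<and> E i ** E i = E i"
    using diag by (simp add: E_def col_row_idempotent)
  ultimately show ?rhs
    using n by metis
next
  assume ?rhs
  then obtain n and \<alpha> \<beta> \<gamma> \<delta> :: "nat \<Rightarrow> 'a" and E :: "nat \<Rightarrow> 'a^2^2" where n: "n > 0"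
    and E: "\<forall>i\<in>{1..n}. E i = col_row (\<alpha> i) (\<beta> i) (\<gamma> i) (\<delta> i) \<and> E i ** E i = E i"
    and prod: "mat2 a b 0 0 = mat_prod_list (map E [1..<n + 1])"
    by blast
  obtain k where k: "n = Suc k"
    using n by (cases n) auto
  have E_nz: "E i \<noteq> 0" if "i \<in> {1..n}" for i
  proof
    assume "E i = 0"
    then have "0 \<in> set (map E [1..<n + 1])"
      using that by (force simp: image_iff)
    then have "mat2 a b 0 0 = 0"
      unfolding prod by (rule mat_prod_list_eq_0)
    then show False
      using \<open>a \<noteq> 0\<close> by (simp add: mat2_eq_0_iff)
  qed
  have diag: "\<gamma> i * \<alpha> i + \<delta> i * \<beta> i = 1" if "i \<in> {1..n}" for i
    using idempotent_col_row_imp_row_col_one E E_nz that by metis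
  (* The factors 1, ..., i have i - 1 links between them. *)
  define p where "p i = \<alpha> 1 * link_prod \<alpha> \<beta> \<gamma> \<delta> (i - 1)" for i
  have "mat2 a b 0 0 = col_row (\<alpha> 1) (\<beta> 1)
      (link_prod \<alpha> \<beta> \<gamma> \<delta> k * \<gamma> n) (link_prod \<alpha> \<beta> \<gamma> \<delta> k * \<delta> n)"
    using mat_prod_list_col_row[of k E \<alpha> \<beta> \<gamma> \<delta>] E prod k by simp
  then have ab: "a = p n * \<gamma> n" "b = p n * \<delta> n"
    and bottom: "\<beta> 1 * (link_prod \<alpha> \<beta> \<gamma> \<delta> k * \<gamma> n) = 0"
    by (simp_all add: p_def col_row_def mat2_eq_iff k mult.assoc)
  have \<beta>1: "\<beta> 1 = 0"
    using bottom ab(1) \<open>a \<noteq> 0\<close> by (auto simp: p_def k)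
  obtain x y where "a * x + b * y = 1"
  proof -
    have "1 \<in> {a * x + b * y | x y. True}"
      unfolding assms(3) by simp
    then show ?thesis
      using that by force
  qed
  then have pn_inv: "p n * (\<gamma> n * x + \<delta> n * y) = 1"
    by (simp add: ab distrib_left mult.assoc)
  have "\<exists>l. p i * l = 1" if "i \<in> {1..n}" for i
  proof -
    have "i - 1 \<le> n - 1"
      using that by (auto intro: diff_le_mono)
    then obtain r where "link_prod \<alpha> \<beta> \<gamma> \<delta> (n - 1) = link_prod \<alpha> \<beta> \<gamma> \<delta> (i - 1) * r"
      using link_prod_initial_factor by blast
    then have "p n = p i * r"
      by (simp add: p_def mult.assoc)
    then show ?thesis
      using pn_inv by (metis mult.assoc)
  qed
  then obtain l where l: "p i * l i = 1" if "i \<in> {1..n}" for i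
    by metis
  have p_step: "p (i + 1) = p i * (\<gamma> i * \<alpha> (i + 1) + \<delta> i * \<beta> (i + 1))" if "i \<ge> 1" for i
    using that by (cases i) (simp_all add: p_def mult.assoc)
  have p1: "p 1 = \<alpha> 1"
    by (simp add: p_def)
  (* As the second entry of the first column is 0, the first entry has a left inverse,
     which agrees with its right inverse. *)
  have "\<gamma> 1 * \<alpha> 1 = 1" "\<alpha> 1 * l 1 = 1"
    using diag[of 1] l[of 1] \<beta>1 n p1 by auto
  then have "\<alpha> 1 * \<gamma> 1 = 1"
    by (metis mult.assoc mult.left_neutral mult.right_neutral)
  then have start: "\<alpha> 1 * l 1 = 1" "\<beta> 1 * l 1 = 0" "p 1 * \<gamma> 1 = 1"
    using \<open>\<alpha> 1 * l 1 = 1\<close> \<beta>1 p1 by simp_all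
  have "(p i * \<gamma> i) * (\<alpha> i * l i) + (p i * \<delta> i) * (\<beta> i * l i) = 1" if "i \<in> {1..n}" for i
  proof -
    have "(p i * \<gamma> i) * (\<alpha> i * l i) + (p i * \<delta> i) * (\<beta> i * l i) =
        p i * (\<gamma> i * \<alpha> i + \<delta> i * \<beta> i) * l i"
      by (simp add: algebra_simps)
    then show ?thesis
      using diag l that by simp
  qed
  moreover have "(p i * \<gamma> i) * (\<alpha> (i + 1) * l (i + 1)) + (p i * \<delta> i) * (\<beta> (i + 1) * l (i + 1)) = 1"
    if "i \<in> {1..<n}" for i
  proof -
    have "(p i * \<gamma> i) * (\<alpha> (i + 1) * l (i + 1)) + (p i * \<delta> i) * (\<beta> (i + 1) * l (i + 1)) =
        p (i + 1) * l (i + 1)"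
      using p_step[of i] that by (simp add: algebra_simps)
    then show ?thesis
      using l[of "i + 1"] that by simp
  qed
  ultimately show ?lhs
    using n start ab
    by (intro exI[of _ n] exI[of _ "\<lambda>i. \<alpha> i * l i"] exI[of _ "\<lambda>i. \<beta> i * l i"]
        exI[of _ "\<lambda>i. p i * \<gamma> i"] exI[of _ "\<lambda>i. p i * \<delta> i"]) auto
qed

end
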